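(* Let $A$ be a ring and $I$ an ideal of $A$. (1) If $A\bowtie I$ is a strongly ISP-ring, then so is $A$. (2) If $I$ is a finitely generated idempotent ideal of $A$ (i.e. $I^2=I$), then $A\bowtie I$ is a strongly ISP-ring if and only if $A$ is a strongly ISP-ring.
   Context: All rings are commutative with a nonzero unit. The amalgamated duplication of $A$ along the ideal $I$ is the subring $A\bowtie I=\{(a,a+i) : a\in A,\ i\in I\}$ of $A\times A$. An element of a ring is regular if it is not a zero-divisor; an ideal is regular if it contains at least one regular element. A proper ideal $H$ is a radical ideal if $\sqrt H=H$. An ideal $J$ of a ring $R$ is invertible if $JJ'=R$ for some $R$-submodule $J'$ of the total quotient ring $T(R)$; equivalently, $J$ is finitely generated, regular, and $J_M$ is a principal ideal of $R_M$ for each maximal ideal $M$ of $R$ (the ideal $R$ itself is allowed). A ring is a strongly ISP-ring if every proper ideal of it (including the zero ideal) can be written as $JH_1\cdots H_n$ with $J$ an invertible ideal, $n\ge 1$, and all $H_i$ proper radical ideals. *)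

theory Defs
  imports "HOL-Algebra.Algebra"
begin

section \<open>Amalgamated duplication\<close>

definition amalgamated_duplication ::
    "('a, 'm) ring_scheme \<Rightarrow> 'a set \<Rightarrow> ('a \<times> 'a) ring"  (infixl \<open>\<bowtie>\<close> 80)
  where "A \<bowtie> I =
    (RDirProd A A)\<lparr>carrier := {(a, a \<oplus>\<^bsub>A\<^esub> i) | a i. a \<in> carrier A \<and> i \<in> I}\<rparr>"


section \<open>Total quotient ring\<close>

definition regular_elements :: "('a, 'm) ring_scheme \<Rightarrow> 'a set"
  where "regular_elements R =
    {s \<in> carrier R. \<forall>x \<in> carrier R. s \<otimes>\<^bsub>R\<^esub> x = \<zero>\<^bsub>R\<^esub> \<longrightarrow> x = \<zero>\<^bsub>R\<^esub>}"

text \<open>The fraction $a/s$ is the class of $(a,s)$. As all denominators are regular, the general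
  localization relation $u(at - bs) = 0$ with $u$ regular reduces to $at = bs$.\<close>

definition fraction :: "('a, 'm) ring_scheme \<Rightarrow> 'a \<Rightarrow> 'a \<Rightarrow> ('a \<times> 'a) set"
  where "fraction R a s =
    {(b, t). b \<in> carrier R \<and> t \<in> regular_elements R \<and> a \<otimes>\<^bsub>R\<^esub> t = b \<otimes>\<^bsub>R\<^esub> s}"

text \<open>The total quotient ring $T(R)$ is a ring and, through $r \cdot (b/t) = (rb)/t$, an
  $R$-module. The unions below range over all representatives; by the lemmas \<open>fraction_add\<close>,
  \<open>fraction_mult\<close> and \<open>fraction_smult\<close> every choice of representatives yields the same class.\<close>

definition total_quotient_ring :: "('a, 'm) ring_scheme \<Rightarrow> ('a, ('a \<times> 'a) set) module"
  where "total_quotient_ring R =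
    \<lparr>carrier = {fraction R a s | a s. a \<in> carrier R \<and> s \<in> regular_elements R},
     monoid.mult = (\<lambda>P Q. \<Union>(a, s) \<in> P. \<Union>(b, t) \<in> Q. fraction R (a \<otimes>\<^bsub>R\<^esub> b) (s \<otimes>\<^bsub>R\<^esub> t)),
     monoid.one = fraction R \<one>\<^bsub>R\<^esub> \<one>\<^bsub>R\<^esub>,
     ring.zero = fraction R \<zero>\<^bsub>R\<^esub> \<one>\<^bsub>R\<^esub>,
     ring.add = (\<lambda>P Q. \<Union>(a, s) \<in> P. \<Union>(b, t) \<in> Q.
              fraction R (a \<otimes>\<^bsub>R\<^esub> t \<oplus>\<^bsub>R\<^esub> b \<otimes>\<^bsub>R\<^esub> s) (s \<otimes>\<^bsub>R\<^esub> t)),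
     module.smult = (\<lambda>r Q. \<Union>(b, t) \<in> Q. fraction R (r \<otimes>\<^bsub>R\<^esub> b) t)\<rparr>"

definition to_total_quotient :: "('a, 'm) ring_scheme \<Rightarrow> 'a \<Rightarrow> ('a \<times> 'a) set"
  where "to_total_quotient R a = fraction R a \<one>\<^bsub>R\<^esub>"


section \<open>Invertible ideals, radical ideals, strongly ISP-rings\<close>

text \<open>\<^const>\<open>ideal_prod\<close> makes sense for arbitrary subsets: it is the set of nonempty finite sums
  of products. Here it is applied inside $T(R)$ to the image of \<open>J\<close> and the submodule \<open>J'\<close>,
  and \<open>R\<close> is identified with its image in $T(R)$.\<close>

definition invertible_ideal :: "('a, 'm) ring_scheme \<Rightarrow> 'a set \<Rightarrow> bool"
  where "invertible_ideal R J \<longleftrightarrow> ideal J R \<and>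
    (\<exists>J'. submodule J' R (total_quotient_ring R) \<and>
       ideal_prod (total_quotient_ring R) (to_total_quotient R ` J) J'
         = to_total_quotient R ` carrier R)"

definition radical :: "('a, 'm) ring_scheme \<Rightarrow> 'a set \<Rightarrow> 'a set"
  where "radical R H = {x \<in> carrier R. \<exists>n::nat. n \<ge> 1 \<and> x [^]\<^bsub>R\<^esub> n \<in> H}"

definition radical_ideal :: "('a, 'm) ring_scheme \<Rightarrow> 'a set \<Rightarrow> bool"
  where "radical_ideal R H \<longleftrightarrow> ideal H R \<and> H \<noteq> carrier R \<and> radical R H = H"

text \<open>\<open>foldl (ideal_prod R) J [H\<^sub>1, \<dots>, H\<^sub>n]\<close> is the product $J H_1 \cdots H_n$.\<close>

locale strongly_ISP_ring = cring R for R (structure) +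
  assumes one_not_zero: "\<one> \<noteq> \<zero>"
    and proper_ideal_factorization:
      "\<And>K. \<lbrakk>ideal K R; K \<noteq> carrier R\<rbrakk> \<Longrightarrow>
         \<exists>J Hs. invertible_ideal R J \<and> Hs \<noteq> [] \<and> (\<forall>H \<in> set Hs. radical_ideal R H) \<and>
                K = foldl (ideal_prod R) J Hs"


section \<open>The constructions yield the expected structures\<close>

lemma (in cring) amalgamated_duplication_cring:
  assumes "ideal I R"
  shows "cring (R \<bowtie> I)"
proof -
  interpret I: ideal I R by fact
  interpret P: ring "RDirProd R R" by (rule RDirProd_ring) (rule ring_axioms)+
  let ?C = "{(a, a \<oplus> i) | a i. a \<in> carrier R \<and> i \<in> I}"
  have sums: "(a \<oplus> i) \<oplus> (b \<oplus> j) = (a \<oplus> b) \<oplus> (i \<oplus> j)"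
    and prods: "(a \<oplus> i) \<otimes> (b \<oplus> j) = (a \<otimes> b) \<oplus> (a \<otimes> j \<oplus> i \<otimes> b \<oplus> i \<otimes> j)"
    if "a \<in> carrier R" "b \<in> carrier R" "i \<in> carrier R" "j \<in> carrier R" for a b i j
    using that by algebra+
  have memI: "(a, b) \<in> ?C" if "a \<in> carrier R" "i \<in> I" "b = a \<oplus> i" for a b i
    using that by blast
  have sub: "?C \<subseteq> carrier (RDirProd R R)"
    by (auto simp: RDirProd_carrier intro: I.Icarr)
  have add_eq: "(a, b) \<oplus>\<^bsub>RDirProd R R\<^esub> (c, d) = (a \<oplus> c, b \<oplus> d)"
    and mult_eq: "(a, b) \<otimes>\<^bsub>RDirProd R R\<^esub> (c, d) = (a \<otimes> c, b \<otimes> d)"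
    and one_eq: "\<one>\<^bsub>RDirProd R R\<^esub> = (\<one>, \<one>)"
    and zero_eq: "\<zero>\<^bsub>RDirProd R R\<^esub> = (\<zero>, \<zero>)" for a b c d
    by (simp_all add: RDirProd_def DirProd_def monoid.defs)
  have neg_eq: "\<ominus>\<^bsub>RDirProd R R\<^esub> (a, b) = (\<ominus> a, \<ominus> b)"
    if "a \<in> carrier R" "b \<in> carrier R" for a b
  proof (rule P.minus_equality)
    show "(\<ominus> a, \<ominus> b) \<oplus>\<^bsub>RDirProd R R\<^esub> (a, b) = \<zero>\<^bsub>RDirProd R R\<^esub>"
      using that by (simp add: add_eq zero_eq l_neg)
  qed (use that in \<open>simp_all add: RDirProd_carrier\<close>)
  have "subcring ?C (RDirProd R R)"
  proof (rule P.subcringI[OF P.subringI])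
    show "?C \<subseteq> carrier (RDirProd R R)" by fact
    show "\<one>\<^bsub>RDirProd R R\<^esub> \<in> ?C"
      unfolding one_eq by (rule memI[of _ \<zero>]) simp_all
    show "\<ominus>\<^bsub>RDirProd R R\<^esub> h \<in> ?C" if hC: "h \<in> ?C" for h
    proof -
      obtain a i where h: "h = (a, a \<oplus> i)" "a \<in> carrier R" "i \<in> I" using hC by blast
      note i = I.Icarr[OF h(3)]
      have "\<ominus>\<^bsub>RDirProd R R\<^esub> h = (\<ominus> a, \<ominus> a \<oplus> \<ominus> i)"
        by (simp add: h i neg_eq minus_add)
      moreover have "(\<ominus> a, \<ominus> a \<oplus> \<ominus> i) \<in> ?C"
        by (rule memI[of _ "\<ominus> i"]) (simp_all add: h)
      ultimately show ?thesis by simp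
    qed
    fix h k assume hk: "h \<in> ?C" "k \<in> ?C"
    obtain a i where h: "h = (a, a \<oplus> i)" "a \<in> carrier R" "i \<in> I" using hk(1) by blast
    obtain b j where k: "k = (b, b \<oplus> j)" "b \<in> carrier R" "j \<in> I" using hk(2) by blast
    note ij = I.Icarr[OF h(3)] I.Icarr[OF k(3)]
    show "h \<otimes>\<^bsub>RDirProd R R\<^esub> k \<in> ?C"
      unfolding h(1) k(1) mult_eq
      by (rule memI[of _ "a \<otimes> j \<oplus> i \<otimes> b \<oplus> i \<otimes> j"])
         (simp_all add: h k ij prods I.I_l_closed I.I_r_closed)
    show "h \<oplus>\<^bsub>RDirProd R R\<^esub> k \<in> ?C"
      unfolding h(1) k(1) add_eq
      by (rule memI[of _ "i \<oplus> j"]) (simp_all add: h k ij sums)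
    show "h \<otimes>\<^bsub>RDirProd R R\<^esub> k = k \<otimes>\<^bsub>RDirProd R R\<^esub> h"
      unfolding h(1) k(1) mult_eq by (simp add: h k ij m_comm)
  qed
  then show ?thesis
    using P.subcring_iff[OF sub] by (simp add: amalgamated_duplication_def)
qed

context cring
begin

lemma regular_closed: "s \<in> regular_elements R \<Longrightarrow> s \<in> carrier R"
  by (simp add: regular_elements_def)

lemma regular_one: "\<one> \<in> regular_elements R"
  by (simp add: regular_elements_def)

lemma regular_mult:
  assumes "s \<in> regular_elements R" "t \<in> regular_elements R"
  shows "s \<otimes> t \<in> regular_elements R"
proof -
  note [simp] = assms[THEN regular_closed]
  have "x = \<zero>" if "x \<in> carrier R" "s \<otimes> t \<otimes> x = \<zero>" for x
  proof -
    have "s \<otimes> (t \<otimes> x) = \<zero>" using that by (simp add: m_assoc)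
    then have "t \<otimes> x = \<zero>" using assms(1) that(1) unfolding regular_elements_def by simp
    then show ?thesis using assms(2) that(1) unfolding regular_elements_def by simp
  qed
  then show ?thesis unfolding regular_elements_def by simp
qed

lemma regular_cancel:
  assumes "s \<in> regular_elements R" "x \<in> carrier R" "y \<in> carrier R" "s \<otimes> x = s \<otimes> y"
  shows "x = y"
proof -
  have s: "s \<in> carrier R" using assms(1) by (rule regular_closed)
  have "s \<otimes> (x \<ominus> y) = s \<otimes> x \<ominus> s \<otimes> y"
    using assms(2,3) s by (simp add: minus_eq r_distr r_minus)
  also have "\<dots> = \<zero>" using assms(3) s by (simp add: assms(4) minus_eq r_neg)
  finally have "x \<ominus> y = \<zero>"
    using assms(1) minus_closed[OF assms(2,3)] unfolding regular_elements_def by blast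
  then show ?thesis using assms(2,3) by simp
qed

lemma fraction_eq_iff:
  assumes "a \<in> carrier R" "s \<in> regular_elements R" "b \<in> carrier R" "t \<in> regular_elements R"
  shows "fraction R a s = fraction R b t \<longleftrightarrow> a \<otimes> t = b \<otimes> s"
proof
  assume "fraction R a s = fraction R b t"
  moreover have "(b, t) \<in> fraction R b t" using assms by (simp add: fraction_def)
  ultimately have "(b, t) \<in> fraction R a s" by simp
  then show "a \<otimes> t = b \<otimes> s" by (simp add: fraction_def)
next
  have key: "fraction R a s \<subseteq> fraction R b t"
    if "a \<in> carrier R" "s \<in> regular_elements R" "b \<in> carrier R" "t \<in> regular_elements R"
      and eq: "a \<otimes> t = b \<otimes> s" for a b s t
  proof
    fix p assume "p \<in> fraction R a s"
    then obtain c u where p: "p = (c, u)" "c \<in> carrier R" "u \<in> regular_elements R"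
      "a \<otimes> u = c \<otimes> s" by (auto simp: fraction_def)
    note [simp] = that(1,3) p(2) regular_closed[OF that(2)] regular_closed[OF that(4)]
      regular_closed[OF p(3)]
    have "s \<otimes> (b \<otimes> u) = (b \<otimes> s) \<otimes> u" by (simp add: m_ac)
    also have "\<dots> = (a \<otimes> u) \<otimes> t" by (simp add: eq[symmetric] m_ac)
    also have "\<dots> = s \<otimes> (c \<otimes> t)" by (simp add: p m_ac)
    finally have "b \<otimes> u = c \<otimes> t" using regular_cancel[OF that(2)] by simp
    then show "p \<in> fraction R b t" using p by (simp add: fraction_def)
  qed
  show "fraction R a s = fraction R b t" if "a \<otimes> t = b \<otimes> s"
    using key[OF assms that] key[OF assms(3,4,1,2) that[symmetric]] by (rule equalityI)
qed

lemma fraction_eqI: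
  assumes "a \<otimes> t = b \<otimes> s"
    and "a \<in> carrier R" "s \<in> regular_elements R" "b \<in> carrier R" "t \<in> regular_elements R"
  shows "fraction R a s = fraction R b t"
  using assms fraction_eq_iff by blast

lemma fraction_self: "\<lbrakk>a \<in> carrier R; s \<in> regular_elements R\<rbrakk> \<Longrightarrow> (a, s) \<in> fraction R a s"
  by (simp add: fraction_def)

lemma fraction_memD:
  assumes "(b, t) \<in> fraction R a s"
  shows "b \<in> carrier R" "t \<in> regular_elements R" "a \<otimes> t = b \<otimes> s"
  using assms by (auto simp: fraction_def)

lemma union_const:
  assumes "p \<in> P" and "\<And>a s. (a, s) \<in> P \<Longrightarrow> f a s = C"
  shows "(\<Union>(a, s) \<in> P. f a s) = C"
  using assms by (intro SUP_eq_const) auto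

lemma fraction_mult:
  assumes "a \<in> carrier R" "s \<in> regular_elements R" "b \<in> carrier R" "t \<in> regular_elements R"
  shows "fraction R a s \<otimes>\<^bsub>total_quotient_ring R\<^esub> fraction R b t = fraction R (a \<otimes> b) (s \<otimes> t)"
proof -
  have eq: "fraction R (a' \<otimes> b') (s' \<otimes> t') = fraction R (a \<otimes> b) (s \<otimes> t)"
    if m: "(a', s') \<in> fraction R a s" "(b', t') \<in> fraction R b t" for a' s' b' t'
  proof -
    note A = fraction_memD[OF m(1)] fraction_memD[OF m(2)]
    note [simp] = assms(1,3) assms(2,4)[THEN regular_closed] A(1,4) A(2,5)[THEN regular_closed]
    have "(a' \<otimes> b') \<otimes> (s \<otimes> t) = (a' \<otimes> s) \<otimes> (b' \<otimes> t)" by (simp add: m_ac)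
    also have "\<dots> = (a \<otimes> s') \<otimes> (b \<otimes> t')" by (simp only: A)
    also have "\<dots> = (a \<otimes> b) \<otimes> (s' \<otimes> t')" by (simp add: m_ac)
    finally show ?thesis by (rule fraction_eqI) (simp_all add: regular_mult A(2,5) assms)
  qed
  show ?thesis
    by (simp add: total_quotient_ring_def)
       (intro union_const[OF fraction_self[OF assms(1,2)]]
          union_const[OF fraction_self[OF assms(3,4)]] eq)
qed

lemma fraction_add:
  assumes "a \<in> carrier R" "s \<in> regular_elements R" "b \<in> carrier R" "t \<in> regular_elements R"
  shows "fraction R a s \<oplus>\<^bsub>total_quotient_ring R\<^esub> fraction R b t = fraction R (a \<otimes> t \<oplus> b \<otimes> s) (s \<otimes> t)"
proof -
  have eq: "fraction R (a' \<otimes> t' \<oplus> b' \<otimes> s') (s' \<otimes> t') = fraction R (a \<otimes> t \<oplus> b \<otimes> s) (s \<otimes> t)"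
    if m: "(a', s') \<in> fraction R a s" "(b', t') \<in> fraction R b t" for a' s' b' t'
  proof -
    note A = fraction_memD[OF m(1)] fraction_memD[OF m(2)]
    note [simp] = assms(1,3) assms(2,4)[THEN regular_closed] A(1,4) A(2,5)[THEN regular_closed]
    have "(a' \<otimes> t' \<oplus> b' \<otimes> s') \<otimes> (s \<otimes> t) = (a' \<otimes> s) \<otimes> (t \<otimes> t') \<oplus> (b' \<otimes> t) \<otimes> (s \<otimes> s')"
      by (simp add: l_distr r_distr m_ac)
    also have "\<dots> = (a \<otimes> s') \<otimes> (t \<otimes> t') \<oplus> (b \<otimes> t') \<otimes> (s \<otimes> s')" by (simp only: A)
    also have "\<dots> = (a \<otimes> t \<oplus> b \<otimes> s) \<otimes> (s' \<otimes> t')" by (simp add: l_distr r_distr m_ac)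
    finally show ?thesis by (rule fraction_eqI) (simp_all add: regular_mult A(2,5) assms)
  qed
  show ?thesis
    by (simp add: total_quotient_ring_def)
       (intro union_const[OF fraction_self[OF assms(1,2)]]
          union_const[OF fraction_self[OF assms(3,4)]] eq)
qed

lemma fraction_smult:
  assumes "r \<in> carrier R" "b \<in> carrier R" "t \<in> regular_elements R"
  shows "r \<odot>\<^bsub>total_quotient_ring R\<^esub> fraction R b t = fraction R (r \<otimes> b) t"
proof -
  have eq: "fraction R (r \<otimes> b') t' = fraction R (r \<otimes> b) t" if m: "(b', t') \<in> fraction R b t" for b' t'
  proof -
    note A = fraction_memD[OF m]
    note [simp] = assms(1,2) assms(3)[THEN regular_closed] A(1) A(2)[THEN regular_closed]
    have "(r \<otimes> b') \<otimes> t = (r \<otimes> b) \<otimes> t'" by (simp add: m_assoc A(3))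
    then show ?thesis by (rule fraction_eqI) (simp_all add: A(2) assms)
  qed
  show ?thesis
    by (simp add: total_quotient_ring_def)
       (intro union_const[OF fraction_self[OF assms(2,3)]] eq)
qed

lemma total_quotient_carrier:
  "carrier (total_quotient_ring R) =
     {fraction R a s | a s. a \<in> carrier R \<and> s \<in> regular_elements R}"
  and total_quotient_one: "\<one>\<^bsub>total_quotient_ring R\<^esub> = fraction R \<one> \<one>"
  and total_quotient_zero: "\<zero>\<^bsub>total_quotient_ring R\<^esub> = fraction R \<zero> \<one>"
  by (simp_all add: total_quotient_ring_def)

lemma fraction_closed:
  "\<lbrakk>a \<in> carrier R; s \<in> regular_elements R\<rbrakk> \<Longrightarrow> fraction R a s \<in> carrier (total_quotient_ring R)"
  by (auto simp: total_quotient_carrier)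

lemma total_quotient_cases:
  assumes "x \<in> carrier (total_quotient_ring R)"
  obtains a s where "a \<in> carrier R" "s \<in> regular_elements R" "x = fraction R a s"
  using assms by (auto simp: total_quotient_carrier)

lemma total_quotient_cring: "cring (total_quotient_ring R)"
proof -
  note [simp] = regular_closed regular_one regular_mult total_quotient_one total_quotient_zero
    fraction_add fraction_mult fraction_closed
  have "abelian_group (total_quotient_ring R)"
  proof (rule abelian_groupI, goal_cases)
    case (1 x y) then show ?case by (auto elim!: total_quotient_cases)
  next
    case 2 show ?case by simp
  next
    case (3 x y z)
    from 3(1) obtain a s where x: "a \<in> carrier R" "s \<in> regular_elements R" "x = fraction R a s"
      by (rule total_quotient_cases)
    from 3(2) obtain b t where y: "b \<in> carrier R" "t \<in> regular_elements R" "y = fraction R b t"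
      by (rule total_quotient_cases)
    from 3(3) obtain c u where z: "c \<in> carrier R" "u \<in> regular_elements R" "z = fraction R c u"
      by (rule total_quotient_cases)
    from x y z show ?case by (simp add: l_distr r_distr m_ac a_ac)
  next
    case (4 x y)
    from 4(1) obtain a s where x: "a \<in> carrier R" "s \<in> regular_elements R" "x = fraction R a s"
      by (rule total_quotient_cases)
    from 4(2) obtain b t where y: "b \<in> carrier R" "t \<in> regular_elements R" "y = fraction R b t"
      by (rule total_quotient_cases)
    from x y show ?case by (simp add: m_ac a_ac)
  next
    case (5 x) then show ?case by (auto elim!: total_quotient_cases)
  next
    case (6 x)
    then obtain a s where x: "a \<in> carrier R" "s \<in> regular_elements R" "x = fraction R a s"
      by (rule total_quotient_cases)
    have "fraction R (\<ominus> a \<otimes> s \<oplus> a \<otimes> s) (s \<otimes> s) = fraction R \<zero> \<one>"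
      using x by (intro fraction_eqI) (simp_all add: l_minus l_neg)
    with x show ?case by (intro bexI[of _ "fraction R (\<ominus> a) s"]) simp_all
  qed
  moreover have "comm_monoid (total_quotient_ring R)"
  proof (rule comm_monoidI, goal_cases)
    case (1 x y) then show ?case by (auto elim!: total_quotient_cases)
  next
    case 2 show ?case by simp
  next
    case (3 x y z) then show ?case by (auto elim!: total_quotient_cases simp: m_ac)
  next
    case (4 x) then show ?case by (auto elim!: total_quotient_cases)
  next
    case (5 x y) then show ?case by (auto elim!: total_quotient_cases simp: m_ac)
  qed
  moreover have "(x \<oplus>\<^bsub>total_quotient_ring R\<^esub> y) \<otimes>\<^bsub>total_quotient_ring R\<^esub> z =
      x \<otimes>\<^bsub>total_quotient_ring R\<^esub> z \<oplus>\<^bsub>total_quotient_ring R\<^esub> y \<otimes>\<^bsub>total_quotient_ring R\<^esub> z"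
    if xyz: "x \<in> carrier (total_quotient_ring R)" "y \<in> carrier (total_quotient_ring R)"
      "z \<in> carrier (total_quotient_ring R)" for x y z
  proof -
    from xyz(1) obtain a s where x: "a \<in> carrier R" "s \<in> regular_elements R" "x = fraction R a s"
      by (rule total_quotient_cases)
    from xyz(2) obtain b t where y: "b \<in> carrier R" "t \<in> regular_elements R" "y = fraction R b t"
      by (rule total_quotient_cases)
    from xyz(3) obtain c u where z: "c \<in> carrier R" "u \<in> regular_elements R" "z = fraction R c u"
      by (rule total_quotient_cases)
    have "fraction R ((a \<otimes> t \<oplus> b \<otimes> s) \<otimes> c) ((s \<otimes> t) \<otimes> u) =
        fraction R ((a \<otimes> c) \<otimes> (t \<otimes> u) \<oplus> (b \<otimes> c) \<otimes> (s \<otimes> u)) ((s \<otimes> u) \<otimes> (t \<otimes> u))"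
      using x y z by (intro fraction_eqI) (simp_all add: l_distr r_distr m_ac)
    with x y z show ?thesis by simp
  qed
  ultimately show ?thesis by (rule cringI)
qed

lemma total_quotient_algebra: "algebra R (total_quotient_ring R)"
proof -
  note [simp] = regular_closed regular_one regular_mult fraction_add fraction_mult fraction_smult
    fraction_closed
  interpret T: cring "total_quotient_ring R" by (rule total_quotient_cring)
  have "module R (total_quotient_ring R)"
  proof (rule moduleI[OF cring_axioms T.abelian_group_axioms], goal_cases)
    case (1 a x) then show ?case by (auto elim!: total_quotient_cases)
  next
    case (2 a b x)
    from 2(3) obtain c s where x: "c \<in> carrier R" "s \<in> regular_elements R" "x = fraction R c s"
      by (rule total_quotient_cases)
    have "fraction R ((a \<oplus> b) \<otimes> c) s = fraction R (a \<otimes> c \<otimes> s \<oplus> b \<otimes> c \<otimes> s) (s \<otimes> s)"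
      using x 2 by (intro fraction_eqI) (simp_all add: l_distr r_distr m_ac)
    with x 2 show ?case by simp
  next
    case (3 a x y)
    from 3(2) obtain b s where x: "b \<in> carrier R" "s \<in> regular_elements R" "x = fraction R b s"
      by (rule total_quotient_cases)
    from 3(3) obtain c t where y: "c \<in> carrier R" "t \<in> regular_elements R" "y = fraction R c t"
      by (rule total_quotient_cases)
    from x y 3 show ?case by (simp add: l_distr r_distr m_ac)
  next
    case (4 a b x) then show ?case by (auto elim!: total_quotient_cases simp: m_ac)
  next
    case (5 x) then show ?case by (auto elim!: total_quotient_cases)
  qed
  moreover have "(a \<odot>\<^bsub>total_quotient_ring R\<^esub> x) \<otimes>\<^bsub>total_quotient_ring R\<^esub> y =
      a \<odot>\<^bsub>total_quotient_ring R\<^esub> (x \<otimes>\<^bsub>total_quotient_ring R\<^esub> y)"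
    if "a \<in> carrier R" "x \<in> carrier (total_quotient_ring R)" "y \<in> carrier (total_quotient_ring R)"
    for a x y
    using that by (auto elim!: total_quotient_cases simp: m_ac)
  ultimately show ?thesis
    by (intro algebra.intro algebra_axioms.intro) (auto intro: T.cring_axioms)
qed

lemma to_total_quotient_hom: "to_total_quotient R \<in> ring_hom R (total_quotient_ring R)"
  by (rule ring_hom_memI)
     (simp_all add: to_total_quotient_def fraction_closed total_quotient_one fraction_add
        fraction_mult regular_one)

lemma to_total_quotient_inj: "inj_on (to_total_quotient R) (carrier R)"
  by (rule inj_onI) (simp add: to_total_quotient_def fraction_eq_iff regular_one)

lemma to_total_quotient_regular_Unit:
  assumes "s \<in> regular_elements R"
  shows "to_total_quotient R s \<in> Units (total_quotient_ring R)"
proof -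
  have "fraction R \<one> s \<otimes>\<^bsub>total_quotient_ring R\<^esub> to_total_quotient R s = \<one>\<^bsub>total_quotient_ring R\<^esub>"
    "to_total_quotient R s \<otimes>\<^bsub>total_quotient_ring R\<^esub> fraction R \<one> s = \<one>\<^bsub>total_quotient_ring R\<^esub>"
    using assms
    by (simp_all add: to_total_quotient_def fraction_mult fraction_eq_iff regular_one regular_closed
        total_quotient_one)
  moreover have "to_total_quotient R s \<in> carrier (total_quotient_ring R)"
    "fraction R \<one> s \<in> carrier (total_quotient_ring R)"
    using assms regular_one regular_closed
    by (auto simp: to_total_quotient_def total_quotient_carrier)
  ultimately show ?thesis unfolding Units_def by blast
qed

end

end

theory Submission
  imports Defs
begin

text \<open>An ideal $J$ is invertible iff $JL = sR$ for some ideal $L$ and some regular $s$, so invertible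
  ideals are preserved by surjective homomorphisms that map regular elements to regular elements.
  Such homomorphisms also carry factorizations over: if $K'$ is the preimage of $K$ and
  $K' = J H_1 \cdots H_n$, then every $H_i$ contains the kernel, so its image is again a proper
  radical ideal. The projection $A \bowtie I \to A$ is of this kind, which gives (1). For (2), a
  finitely generated idempotent ideal is generated by an idempotent $e$, and $A \bowtie I$ is the
  image of $A \times A$ under $(a, b) \mapsto (a, (1-e)a + eb)$; direct products of strongly
  ISP-rings are strongly ISP-rings.\<close>

section \<open>Invertible ideals without fractions\<close>

context cring
begin

lemma fraction_add_same:
  assumes "a \<in> carrier R" "b \<in> carrier R" "s \<in> regular_elements R"
  shows "fraction R a s \<oplus>\<^bsub>total_quotient_ring R\<^esub> fraction R b s = fraction R (a \<oplus> b) s"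
proof -
  note [simp] = assms(1,2) regular_closed[OF assms(3)]
  have "fraction R (a \<otimes> s \<oplus> b \<otimes> s) (s \<otimes> s) = fraction R (a \<oplus> b) s"
    by (rule fraction_eqI) (simp_all add: l_distr r_distr m_ac assms regular_mult)
  then show ?thesis by (simp add: fraction_add assms)
qed

lemma fraction_mult_both:
  assumes "b \<in> carrier R" "s \<in> regular_elements R" "t \<in> regular_elements R"
  shows "fraction R (b \<otimes> t) (s \<otimes> t) = fraction R b s"
  using assms by (intro fraction_eqI) (simp_all add: m_ac regular_mult regular_closed)

lemma fraction_zero:
  "s \<in> regular_elements R \<Longrightarrow> fraction R \<zero> s = \<zero>\<^bsub>total_quotient_ring R\<^esub>"
  unfolding total_quotient_zero
  by (intro fraction_eqI) (simp_all add: regular_one regular_closed)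

text \<open>Over a fixed denominator, adding fractions and scaling them by ring elements act on the
  numerators alone, so closure passes from the submodule \<open>N\<close> to the numerators. These
  ideals supply the \<open>L\<close> of \<open>invertible_idealE\<close>.\<close>

lemma numerators_ideal:
  assumes "submodule N R (total_quotient_ring R)" "s \<in> regular_elements R"
  shows "ideal {b \<in> carrier R. fraction R b s \<in> N} R" (is "ideal ?L R")
proof -
  interpret T: algebra R "total_quotient_ring R" by (rule total_quotient_algebra)
  note N = T.submoduleE[OF assms(1)]
  have zero: "\<zero> \<in> ?L"
    using assms submodule.axioms(1)[OF assms(1)] subgroup.one_closed[of N]
    by (fastforce simp: fraction_zero)
  have add: "x \<oplus> y \<in> ?L" if "x \<in> ?L" "y \<in> ?L" for x y
    using that assms(2) N(5) by (auto simp: fraction_add_same[symmetric])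
  have mult: "x \<otimes> y \<in> ?L" if "y \<in> ?L" "x \<in> carrier R" for x y
    using that assms(2) N(4) by (auto simp: fraction_smult[symmetric])
  have neg: "\<ominus> x \<in> ?L" if "x \<in> ?L" for x
    using mult[OF that, of "\<ominus> \<one>"] that by (simp add: l_minus)
  show ?thesis
  proof (rule idealI[OF ring_axioms])
    show "subgroup ?L (add_monoid R)"
    proof (rule add.subgroupI)
      show "?L \<noteq> {}" using zero by blast
      show "\<ominus> a \<in> ?L" if "a \<in> ?L" for a
        using neg[OF that] .
      show "a \<oplus> b \<in> ?L" if "a \<in> ?L" "b \<in> ?L" for a b
        using add[OF that] .
    qed auto
    show "x \<otimes> a \<in> ?L" "a \<otimes> x \<in> ?L" if "a \<in> ?L" "x \<in> carrier R" for a x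
    proof -
      show "x \<otimes> a \<in> ?L" using mult that by blast
      then show "a \<otimes> x \<in> ?L" using that m_comm[of a x] by auto
    qed
  qed
qed

text \<open>Clearing denominators: 1 in JN is a finite sum of products, so 1 = c/s with c in JL,
  where L collects the numerators of N over s. Hence s lies in JL. Conversely JN = R forces JL into
  sR.\<close>

lemma invertible_idealE:
  assumes "invertible_ideal R J"
  obtains L s where "ideal L R" "s \<in> regular_elements R" "ideal_prod R J L = PIdl s"
proof -
  let ?T = "total_quotient_ring R" and ?\<iota> = "to_total_quotient R"
  from assms obtain N where J: "ideal J R" and N: "submodule N R ?T"
    and JN: "ideal_prod ?T (?\<iota> ` J) N = ?\<iota> ` carrier R"
    unfolding invertible_ideal_def by blast
  interpret T: algebra R ?T by (rule total_quotient_algebra)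
  note NE = T.submoduleE[OF N]
  define L where "L s = {b \<in> carrier R. fraction R b s \<in> N}" for s
  note idealL = numerators_ideal[OF N, folded L_def]
  note Jc = ideal.Icarr[OF J]
  note prod_carr = subsetD[OF ideal_prod_in_carrier[OF J idealL]]
  \<comment> \<open>Since bt/(st) = b/s, multiplying by t carries numerators over s to numerators
    over st. This brings two summands to a common denominator.\<close>
  have scale: "c \<otimes> t \<in> ideal_prod R J (L (s \<otimes> t))"
    if "c \<in> ideal_prod R J (L s)" "s \<in> regular_elements R" "t \<in> regular_elements R" for c s t
    using that(1)
  proof induction
    case (prod a b)
    have "b \<otimes> t \<in> L (s \<otimes> t)"
      using prod that(2,3) by (simp add: L_def fraction_mult_both regular_closed)
    then have "a \<otimes> (b \<otimes> t) \<in> ideal_prod R J (L (s \<otimes> t))"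
      using prod by (intro ideal_prod.prod)
    then show ?case using prod that(3) Jc by (simp add: L_def m_assoc regular_closed)
  next
    case (sum c d)
    then show ?case
      using that(2,3) prod_carr by (simp add: l_distr regular_closed ideal_prod.sum)
  qed
  \<comment> \<open>Each element of JN is a single fraction whose numerator lies in J times the
    numerator ideal of its denominator. A sum of fractions over s and t is written over st.\<close>
  have common: "\<exists>s \<in> regular_elements R. \<exists>c \<in> ideal_prod R J (L s). x = fraction R c s"
    if "x \<in> ideal_prod ?T (?\<iota> ` J) N" for x
    using that
  proof induction
    case (prod x y)
    from prod(1) obtain a where a: "a \<in> J" "x = fraction R a \<one>"
      by (auto simp: to_total_quotient_def)
    from prod(2) have "y \<in> carrier ?T" using NE(1) by auto
    then obtain b s where b: "b \<in> carrier R" "s \<in> regular_elements R" "y = fraction R b s"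
      by (rule total_quotient_cases)
    have "a \<otimes> b \<in> ideal_prod R J (L s)"
      using a b prod(2) by (intro ideal_prod.prod) (simp_all add: L_def)
    moreover have "x \<otimes>\<^bsub>?T\<^esub> y = fraction R (a \<otimes> b) s"
      using a b Jc by (simp add: fraction_mult regular_one regular_closed)
    ultimately show ?case using b(2) by blast
  next
    case (sum x y)
    then obtain s c t d where *: "s \<in> regular_elements R" "c \<in> ideal_prod R J (L s)"
        "x = fraction R c s" "t \<in> regular_elements R" "d \<in> ideal_prod R J (L t)"
        "y = fraction R d t" by blast
    have "d \<otimes> s \<in> ideal_prod R J (L (s \<otimes> t))"
      using scale[OF *(5,4,1)] * by (simp add: m_comm regular_closed)
    then have "c \<otimes> t \<oplus> d \<otimes> s \<in> ideal_prod R J (L (s \<otimes> t))"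
      using scale[OF *(2,1,4)] by (intro ideal_prod.sum)
    moreover have "x \<oplus>\<^bsub>?T\<^esub> y = fraction R (c \<otimes> t \<oplus> d \<otimes> s) (s \<otimes> t)"
      using * prod_carr by (simp add: fraction_add)
    ultimately show ?case using regular_mult *(1,4) by blast
  qed
  have "fraction R \<one> \<one> \<in> ideal_prod ?T (?\<iota> ` J) N"
    unfolding JN by (auto simp: to_total_quotient_def)
  from common[OF this] obtain s c where s: "s \<in> regular_elements R"
    and c: "c \<in> ideal_prod R J (L s)" and eq: "fraction R \<one> \<one> = fraction R c s" by blast
  \<comment> \<open>1/1 = c/s says c = s, which puts the generator of sR into JL.\<close>
  have "c = s"
    using eq s c prod_carr[OF s c] by (simp add: fraction_eq_iff regular_one regular_closed)
  then have "PIdl s \<subseteq> ideal_prod R J (L s)"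
    using c cgenideal_minimal[OF ideal_prod_is_ideal[OF J idealL[OF s]]] by simp
  moreover have "ideal_prod R J (L s) \<subseteq> PIdl s"
  proof
    interpret P: ideal "PIdl s" R using s by (intro cgenideal_ideal regular_closed)
    fix x assume "x \<in> ideal_prod R J (L s)"
    then show "x \<in> PIdl s"
    proof induction
      case (prod a b)
      have b: "b \<in> carrier R" "fraction R b s \<in> N" using prod by (auto simp: L_def)
      \<comment> \<open>ab/s lies in JN = R, hence equals some r/1, so ab = rs.\<close>
      have "?\<iota> a \<otimes>\<^bsub>?T\<^esub> fraction R b s \<in> ?\<iota> ` carrier R"
        unfolding JN[symmetric] using b prod by (intro ideal_prod.prod imageI)
      then obtain r where r: "r \<in> carrier R" "fraction R (a \<otimes> b) s = fraction R r \<one>"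
        using b s prod Jc
        by (auto simp: to_total_quotient_def fraction_mult regular_one regular_closed)
      then have "a \<otimes> b = r \<otimes> s"
        using b s prod Jc by (simp add: fraction_eq_iff regular_one)
      then show ?case unfolding cgenideal_def using r(1) by blast
    next
      case (sum x y)
      then show ?case by (intro P.a_closed)
    qed
  qed
  ultimately show ?thesis using that idealL s by blast
qed

text \<open>The inverse module is N = (1/s)L: then JN = (1/s)JL = (1/s)sR = R.\<close>

lemma invertible_idealI:
  assumes J: "ideal J R" and L: "ideal L R" and s: "s \<in> regular_elements R"
    and JL: "ideal_prod R J L = PIdl s"
  shows "invertible_ideal R J"
proof -
  let ?T = "total_quotient_ring R" and ?\<iota> = "to_total_quotient R"
  interpret T: algebra R ?T by (rule total_quotient_algebra)
  interpret L: ideal L R by (rule L)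
  note Jc = ideal.Icarr[OF J]
  define N where "N = (\<lambda>b. fraction R b s) ` L"
  note prod_carr = subsetD[OF ideal_prod_in_carrier[OF J L]]
  have "submodule N R ?T"
  proof (rule T.submoduleI)
    show "N \<subseteq> carrier ?T"
      using s by (auto simp: N_def fraction_closed)
    show "\<zero>\<^bsub>?T\<^esub> \<in> N"
      using s by (auto simp: N_def fraction_zero[symmetric])
    show smult: "a \<odot>\<^bsub>?T\<^esub> x \<in> N" if "a \<in> carrier R" "x \<in> N" for a x
      using s that by (auto simp: N_def fraction_smult L.I_l_closed)
    show "x \<oplus>\<^bsub>?T\<^esub> y \<in> N" if "x \<in> N" "y \<in> N" for x y
      using s that by (auto simp: N_def fraction_add_same)
    show "\<ominus>\<^bsub>?T\<^esub> x \<in> N" if "x \<in> N" for x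
    proof -
      have "x \<in> carrier ?T" using that s by (auto simp: N_def fraction_closed)
      then have "\<ominus>\<^bsub>?T\<^esub> x = (\<ominus> \<one>) \<odot>\<^bsub>?T\<^esub> x" by (simp add: T.smult_l_minus)
      then show ?thesis using smult[of "\<ominus> \<one>" x] that by simp
    qed
  qed
  moreover have "ideal_prod ?T (?\<iota> ` J) N = (\<lambda>c. fraction R c s) ` ideal_prod R J L"
  proof (intro equalityI subsetI)
    fix x assume "x \<in> ideal_prod ?T (?\<iota> ` J) N"
    then show "x \<in> (\<lambda>c. fraction R c s) ` ideal_prod R J L"
    proof induction
      case (prod x y)
      then obtain a b where ab: "a \<in> J" "b \<in> L" "x = fraction R a \<one>" "y = fraction R b s"
        by (auto simp: N_def to_total_quotient_def)
      then have "x \<otimes>\<^bsub>?T\<^esub> y = fraction R (a \<otimes> b) s"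
        using s Jc by (simp add: fraction_mult regular_one regular_closed)
      then show ?case using ideal_prod.prod[OF ab(1,2)] by (metis imageI)
    next
      case (sum x y)
      then obtain c d where cd: "c \<in> ideal_prod R J L" "d \<in> ideal_prod R J L"
        "x = fraction R c s" "y = fraction R d s" by blast
      then have "x \<oplus>\<^bsub>?T\<^esub> y = fraction R (c \<oplus> d) s"
        using s prod_carr by (simp add: fraction_add_same)
      then show ?case using ideal_prod.sum[OF cd(1,2)] by (metis imageI)
    qed
  next
    fix x assume "x \<in> (\<lambda>c. fraction R c s) ` ideal_prod R J L"
    then obtain c where "c \<in> ideal_prod R J L" and x: "x = fraction R c s" by blast
    then have "fraction R c s \<in> ideal_prod ?T (?\<iota> ` J) N"
    proof (induction arbitrary: x)
      case (prod a b)
      then have "?\<iota> a \<otimes>\<^bsub>?T\<^esub> fraction R b s \<in> ideal_prod ?T (?\<iota> ` J) N"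
        by (intro ideal_prod.prod) (auto simp: N_def)
      moreover have "?\<iota> a \<otimes>\<^bsub>?T\<^esub> fraction R b s = fraction R (a \<otimes> b) s"
        using prod s Jc
        by (simp add: to_total_quotient_def fraction_mult regular_one regular_closed)
      ultimately show ?case by simp
    next
      case (sum c d)
      then have "fraction R c s \<oplus>\<^bsub>?T\<^esub> fraction R d s \<in> ideal_prod ?T (?\<iota> ` J) N"
        by (intro ideal_prod.sum) auto
      then show ?case using sum.hyps s prod_carr by (simp add: fraction_add_same)
    qed
    then show "x \<in> ideal_prod ?T (?\<iota> ` J) N" by (simp add: x)
  qed
  moreover have "(\<lambda>c. fraction R c s) ` (PIdl s) = ?\<iota> ` carrier R"
  proof -
    have "fraction R (r \<otimes> s) s = ?\<iota> r" if "r \<in> carrier R" for r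
      unfolding to_total_quotient_def using that s
      by (intro fraction_eqI) (simp_all add: regular_one regular_closed)
    moreover have "PIdl s = (\<lambda>r. r \<otimes> s) ` carrier R" by (auto simp: cgenideal_def)
    ultimately show ?thesis by (simp add: image_image)
  qed
  ultimately show ?thesis
    unfolding invertible_ideal_def using J JL by metis
qed

lemma invertible_carrier: "invertible_ideal R (carrier R)"
proof (rule invertible_idealI[of _ "carrier R" \<one>])
  show "ideal_prod R (carrier R) (carrier R) = PIdl \<one>"
    by (simp add: ideal_prod_one oneideal cgenideal_eq_genideal genideal_one)
qed (simp_all add: oneideal regular_one)

lemma foldl_ideal_prod_ideal:
  assumes "ideal J R" "\<forall>H \<in> set Hs. ideal H R"
  shows "ideal (foldl (ideal_prod R) J Hs) R"
  using assms by (induction Hs arbitrary: J) (simp_all add: ideal_prod_is_ideal)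

lemma foldl_ideal_prod_subset:
  assumes "ideal J R" "\<forall>H \<in> set Hs. ideal H R" "H \<in> set Hs"
  shows "foldl (ideal_prod R) J Hs \<subseteq> H"
  using assms(2,3)
\<comment> \<open>\<open>foldl\<close> applies the last factor outermost, so removing factors from
  the end leaves a product of two ideals, which lies in their intersection.\<close>
proof (induction Hs rule: rev_induct)
  case (snoc H' Hs)
  have "foldl (ideal_prod R) J (Hs @ [H']) \<subseteq> foldl (ideal_prod R) J Hs \<inter> H'"
    using snoc.prems foldl_ideal_prod_ideal[OF assms(1), of Hs]
    using ideal_prod_inter[of "foldl (ideal_prod R) J Hs" H'] by simp
  with snoc show ?case by auto
qed simp

end


section \<open>Images under surjective homomorphisms\<close>

context ring_hom_ring
begin

lemma image_ideal:
  assumes I: "ideal I R" and surj: "h ` carrier R = carrier S"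
  shows "ideal (h ` I) S"
proof -
  interpret I: ideal I R by (rule I)
  show ?thesis
  proof (rule idealI[OF S.ring_axioms])
    show "subgroup (h ` I) (add_monoid S)"
    proof (rule S.add.subgroupI)
      show "\<ominus>\<^bsub>S\<^esub> a \<in> h ` I" if "a \<in> h ` I" for a
      proof -
        from that obtain x where x: "x \<in> I" "a = h x" by blast
        then have "\<ominus>\<^bsub>S\<^esub> a = h (\<ominus>\<^bsub>R\<^esub> x)" by simp
        moreover have "\<ominus>\<^bsub>R\<^esub> x \<in> I" using x by simp
        ultimately show ?thesis by (simp only: imageI)
      qed
      show "a \<oplus>\<^bsub>S\<^esub> b \<in> h ` I" if "a \<in> h ` I" "b \<in> h ` I" for a b
      proof -
        from that obtain x y where "x \<in> I" "y \<in> I" "a = h x" "b = h y" by blast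
        then show ?thesis using imageI[of "x \<oplus>\<^bsub>R\<^esub> y" I h] by simp
      qed
      show "h ` I \<noteq> {}" using I.zero_closed by blast
    qed auto
    fix a x assume "a \<in> h ` I" "x \<in> carrier S"
    then obtain b y where by_: "b \<in> I" "a = h b" "y \<in> carrier R" "x = h y"
      using surj by blast
    show "x \<otimes>\<^bsub>S\<^esub> a \<in> h ` I"
      using by_ imageI[of "y \<otimes>\<^bsub>R\<^esub> b" I h] by (simp add: I.I_l_closed)
    show "a \<otimes>\<^bsub>S\<^esub> x \<in> h ` I"
      using by_ imageI[of "b \<otimes>\<^bsub>R\<^esub> y" I h] by (simp add: I.I_r_closed)
  qed
qed

lemma image_ideal_prod:
  assumes "ideal I R" "ideal J R"
  shows "h ` ideal_prod R I J = ideal_prod S (h ` I) (h ` J)"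
proof (intro equalityI subsetI)
  note carr = assms[THEN ideal.Icarr] subsetD[OF R.ideal_prod_in_carrier[OF assms]]
  fix y assume "y \<in> h ` ideal_prod R I J"
  then obtain x where "x \<in> ideal_prod R I J" and y: "y = h x" by blast
  then have "h x \<in> ideal_prod S (h ` I) (h ` J)"
  proof (induction arbitrary: y)
    case (prod i j)
    then show ?case using carr by (auto intro: ideal_prod.prod)
  next
    case (sum s t)
    then show ?case using carr by (auto intro: ideal_prod.sum)
  qed
  then show "y \<in> ideal_prod S (h ` I) (h ` J)" by (simp add: y)
next
  note carr = assms[THEN ideal.Icarr] subsetD[OF R.ideal_prod_in_carrier[OF assms]]
  fix y assume "y \<in> ideal_prod S (h ` I) (h ` J)"
  then show "y \<in> h ` ideal_prod R I J"
  proof induction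
    case (prod a b)
    then obtain i j where "i \<in> I" "j \<in> J" "a = h i" "b = h j" by blast
    then show ?case
      using carr imageI[OF ideal_prod.prod[of i I j J R], of h] by simp
  next
    case (sum a b)
    then obtain s t where "s \<in> ideal_prod R I J" "t \<in> ideal_prod R I J" "a = h s" "b = h t"
      by blast
    then show ?case
      using carr imageI[OF ideal_prod.sum[of s R I J t], of h] by simp
  qed
qed

lemma image_foldl_ideal_prod:
  assumes "ideal J R" "\<forall>H \<in> set Hs. ideal H R"
  shows "h ` foldl (ideal_prod R) J Hs = foldl (ideal_prod S) (h ` J) (map ((`) h) Hs)"
  using assms
  by (induction Hs arbitrary: J) (simp_all add: image_ideal_prod R.ideal_prod_is_ideal)

lemma image_radical_ideal:
  assumes H: "radical_ideal R H" and ker: "a_kernel R S h \<subseteq> H"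
    and surj: "h ` carrier R = carrier S"
  shows "radical_ideal S (h ` H)"
proof -
  interpret H: ideal H R using H by (simp add: radical_ideal_def)
  \<comment> \<open>If h x = h y with y in \<open>H\<close>, then x - y is in the kernel, hence in
    \<open>H\<close>, and x = (x - y) + y.\<close>
  have sat: "x \<in> H" if "x \<in> carrier R" "h x \<in> h ` H" for x
  proof -
    from that obtain y where y: "y \<in> H" "h x = h y" by auto
    have yc: "y \<in> carrier R" using y by auto
    have "h (x \<ominus>\<^bsub>R\<^esub> y) = \<zero>\<^bsub>S\<^esub>"
      using that(1) yc by (simp add: R.minus_eq y(2)[symmetric] S.r_neg)
    moreover have "x \<ominus>\<^bsub>R\<^esub> y \<in> carrier R" using that(1) yc by (rule R.minus_closed)
    ultimately have "x \<ominus>\<^bsub>R\<^esub> y \<in> H" using ker unfolding a_kernel_def' by blast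
    then have "(x \<ominus>\<^bsub>R\<^esub> y) \<oplus>\<^bsub>R\<^esub> y \<in> H" using y(1) by (rule H.a_closed)
    then show ?thesis using that(1) yc by (simp add: R.minus_eq R.a_assoc R.l_neg)
  qed
  have "h ` H \<noteq> carrier S"
    using sat surj H H.a_subset by (auto simp: radical_ideal_def)
  moreover have "radical S (h ` H) \<subseteq> h ` H"
  proof
    fix y assume "y \<in> radical S (h ` H)"
    then obtain n where n: "n \<ge> 1" "y [^]\<^bsub>S\<^esub> (n::nat) \<in> h ` H" "y \<in> carrier S"
      by (auto simp: radical_def)
    then obtain x where x: "x \<in> carrier R" "y = h x" using surj by blast
    then have "x [^]\<^bsub>R\<^esub> n \<in> H" using n by (intro sat) (simp_all add: hom_nat_pow)
    then have "x \<in> radical R H" using n x by (auto simp: radical_def)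
    then show "y \<in> h ` H" using x H by (simp add: radical_ideal_def)
  qed
  moreover have "h ` H \<subseteq> radical S (h ` H)"
    using surj H.a_subset by (auto simp: radical_def intro!: exI[of _ "1::nat"])
  ultimately show ?thesis
    using image_ideal[OF H.is_ideal surj] by (auto simp: radical_ideal_def)
qed

end

text \<open>Applying h to JL = sR gives an equation of the same shape over \<open>S\<close>, and h s
  is regular by \<open>reg\<close>.\<close>

lemma (in ring_hom_cring) image_invertible_ideal:
  assumes "invertible_ideal R J" and surj: "h ` carrier R = carrier S"
    and reg: "h ` regular_elements R \<subseteq> regular_elements S"
  shows "invertible_ideal S (h ` J)"
proof -
  have J: "ideal J R" using assms by (simp add: invertible_ideal_def)
  obtain L s where L: "ideal L R" and s: "s \<in> regular_elements R" "ideal_prod R J L = PIdl\<^bsub>R\<^esub> s"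
    using R.invertible_idealE[OF assms(1)] by metis
  have "h ` (PIdl\<^bsub>R\<^esub> s) = PIdl\<^bsub>S\<^esub> (h s)"
    unfolding cgenideal_def surj[symmetric] using R.regular_closed[OF s(1)] by (auto, force)
  then have "ideal_prod S (h ` J) (h ` L) = PIdl\<^bsub>S\<^esub> (h s)"
    using ring.image_ideal_prod[OF J L] s(2) by simp
  then show ?thesis
    using S.invertible_idealI[OF ring.image_ideal[OF J surj] ring.image_ideal[OF L surj]] reg s(1) by blast
qed

lemma (in ring_hom_cring) strongly_ISP_ring_image:
  assumes R: "strongly_ISP_ring R" and surj: "h ` carrier R = carrier S"
    and reg: "h ` regular_elements R \<subseteq> regular_elements S"
    and one: "\<one>\<^bsub>S\<^esub> \<noteq> \<zero>\<^bsub>S\<^esub>"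
  shows "strongly_ISP_ring S"
proof (intro strongly_ISP_ring.intro strongly_ISP_ring_axioms.intro S.cring_axioms one)
  fix K assume K: "ideal K S" "K \<noteq> carrier S"
  interpret K: ideal K S by (rule K)
  let ?K' = "{r \<in> carrier R. h r \<in> K}"
  have hK: "h ` ?K' = K" using surj K.a_subset by auto
  have "?K' \<noteq> carrier R" using hK K(2) surj by auto
  then obtain J Hs where J: "invertible_ideal R J" and Hs: "Hs \<noteq> []"
    "\<forall>H \<in> set Hs. radical_ideal R H" and eq: "?K' = foldl (ideal_prod R) J Hs"
    using strongly_ISP_ring.proper_ideal_factorization[OF R ring.ideal_vimage[OF K(1)]] by blast
  have ids: "ideal J R" "\<forall>H \<in> set Hs. ideal H R"
    using J Hs by (auto simp: invertible_ideal_def radical_ideal_def)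
  \<comment> \<open>The preimage contains the kernel because 0 is in \<open>K\<close>. As a product
    it lies in each of its factors, so every factor contains the kernel too.\<close>
  have "x \<in> ?K'" if "x \<in> a_kernel R S h" for x
  proof -
    have "x \<in> carrier R" "h x = \<zero>\<^bsub>S\<^esub>" using that unfolding a_kernel_def' by blast+
    then show ?thesis using K.zero_closed by simp
  qed
  then have ker: "a_kernel R S h \<subseteq> H" if "H \<in> set Hs" for H
    using R.foldl_ideal_prod_subset[OF ids that] unfolding eq[symmetric] by fast
  have "K = foldl (ideal_prod S) (h ` J) (map ((`) h) Hs)"
    using ring.image_foldl_ideal_prod[OF ids] unfolding eq[symmetric] hK .
  moreover have "\<forall>H \<in> set (map ((`) h) Hs). radical_ideal S H"
    using Hs ker surj by (auto intro: ring.image_radical_ideal)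
  ultimately show "\<exists>J Hs. invertible_ideal S J \<and> Hs \<noteq> [] \<and> (\<forall>H \<in> set Hs. radical_ideal S H) \<and>
      K = foldl (ideal_prod S) J Hs"
    using image_invertible_ideal[OF J surj reg] Hs(1) by (metis map_is_Nil_conv)
qed

text \<open>Roots pull back because h commutes with powers, and 1 stays outside the preimage because
  h 1 = 1. Applied to the two projections, this makes radical ideals of a direct product out of
  those of its components.\<close>

lemma (in ring_hom_ring) vimage_radical_ideal:
  assumes "radical_ideal S H"
  shows "radical_ideal R {r \<in> carrier R. h r \<in> H}" (is "radical_ideal R ?V")
proof -
  have H: "ideal H S" "H \<noteq> carrier S" "radical S H = H"
    using assms by (simp_all add: radical_ideal_def)
  have "\<one>\<^bsub>R\<^esub> \<notin> ?V" using ideal.one_imp_carrier[OF H(1)] H(2) by auto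
  then have "?V \<noteq> carrier R" using R.one_closed by blast
  moreover have "radical R ?V \<subseteq> ?V"
  proof
    fix x assume "x \<in> radical R ?V"
    then obtain n where "n \<ge> 1" "h (x [^]\<^bsub>R\<^esub> (n::nat)) \<in> H" and x: "x \<in> carrier R"
      by (auto simp: radical_def)
    then have "h x \<in> radical S H" unfolding radical_def by (auto simp: hom_nat_pow)
    then show "x \<in> ?V" using H(3) x by simp
  qed
  moreover have "?V \<subseteq> radical R ?V"
    by (auto simp: radical_def intro!: exI[of _ "1::nat"])
  ultimately show ?thesis
    using ideal_vimage[OF H(1)] unfolding radical_ideal_def by blast
qed


section \<open>Direct products\<close>

text \<open>In a direct product, a factor coming from one component projects to the whole ring in
  the other; such factors drop out of the product there.\<close>

lemma (in cring) foldl_ideal_prod_carrier: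
  assumes "ideal J R" "\<forall>H \<in> set Hs. H = carrier R"
  shows "foldl (ideal_prod R) J Hs = J"
  using assms(2) by (induction Hs) (simp_all add: ideal_prod_one[OF assms(1)])

lemma RDirProd_simps:
  "(a, b) \<oplus>\<^bsub>RDirProd R S\<^esub> (c, d) = (a \<oplus>\<^bsub>R\<^esub> c, b \<oplus>\<^bsub>S\<^esub> d)"
  "(a, b) \<otimes>\<^bsub>RDirProd R S\<^esub> (c, d) = (a \<otimes>\<^bsub>R\<^esub> c, b \<otimes>\<^bsub>S\<^esub> d)"
  "\<one>\<^bsub>RDirProd R S\<^esub> = (\<one>\<^bsub>R\<^esub>, \<one>\<^bsub>S\<^esub>)"
  "\<zero>\<^bsub>RDirProd R S\<^esub> = (\<zero>\<^bsub>R\<^esub>, \<zero>\<^bsub>S\<^esub>)"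
  by (simp_all add: RDirProd_def DirProd_def monoid.defs)

locale cring_product = R: cring R + S: cring S for R and S
begin

abbreviation P where "P \<equiv> RDirProd R S"

lemma cring_P: "cring P"
proof -
  interpret P: ring P by (intro RDirProd_ring R.ring_axioms S.ring_axioms)
  show ?thesis
    by unfold_locales (auto simp: RDirProd_carrier RDirProd_simps R.m_comm S.m_comm)
qed

sublocale P: cring P by (rule cring_P)

sublocale pr1: ring_hom_cring P R fst
  by (intro ring_hom_cring.intro ring_hom_cring_axioms.intro cring_P R.cring_axioms ring_hom_memI)
    (auto simp: RDirProd_carrier RDirProd_simps)

sublocale pr2: ring_hom_cring P S snd
  by (intro ring_hom_cring.intro ring_hom_cring_axioms.intro cring_P S.cring_axioms ring_hom_memI)
    (auto simp: RDirProd_carrier RDirProd_simps)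

lemma fst_surj: "fst ` carrier P = carrier R"
  and snd_surj: "snd ` carrier P = carrier S"
  using R.carrier_not_empty S.carrier_not_empty by (simp_all add: RDirProd_carrier)

text \<open>The idempotents (1,0) and (0,1) separate the coordinates: from (x,y') and (x',y) in
  \<open>K\<close> one gets (x,y) = (1,0)(x,y') + (0,1)(x',y) in \<open>K\<close>.\<close>

lemma ideal_eq_Times:
  assumes "ideal K P"
  shows "K = fst ` K \<times> snd ` K"
proof
  interpret K: ideal K P by (rule assms)
  show "fst ` K \<times> snd ` K \<subseteq> K"
  proof
    fix p assume "p \<in> fst ` K \<times> snd ` K"
    then obtain x y x' y' where K: "(x, y') \<in> K" "(x', y) \<in> K" and p: "p = (x, y)" by auto
    then have c: "x \<in> carrier R" "y' \<in> carrier S" "x' \<in> carrier R" "y \<in> carrier S"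
      using K.Icarr by (auto simp: RDirProd_carrier)
    have "(\<one>\<^bsub>R\<^esub>, \<zero>\<^bsub>S\<^esub>) \<otimes>\<^bsub>P\<^esub> (x, y') \<oplus>\<^bsub>P\<^esub> (\<zero>\<^bsub>R\<^esub>, \<one>\<^bsub>S\<^esub>) \<otimes>\<^bsub>P\<^esub> (x', y) \<in> K"
      using K by (intro K.a_closed K.I_l_closed) (auto simp: RDirProd_carrier)
    then show "p \<in> K" using c p by (simp add: RDirProd_simps)
  qed
qed (rule subset_fst_snd)

lemma Times_ideal:
  assumes "ideal I R" "ideal J S"
  shows "ideal (I \<times> J) P"
proof -
  have "I \<times> J = {p \<in> carrier P. fst p \<in> I} \<inter> {p \<in> carrier P. snd p \<in> J}"
    using assms[THEN ideal.Icarr] by (auto simp: RDirProd_carrier)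
  then show ?thesis
    using P.i_intersect[OF pr1.ring.ideal_vimage[OF assms(1)] pr2.ring.ideal_vimage[OF assms(2)]]
    by (simp only:)
qed

text \<open>The product on the left is an ideal, hence the rectangle of its two projections, and
  projecting commutes with products of ideals.\<close>

lemma foldl_ideal_prod_eq_Times:
  assumes "ideal J P" "\<forall>H \<in> set Hs. ideal H P"
  shows "foldl (ideal_prod P) J Hs = foldl (ideal_prod R) (fst ` J) (map ((`) fst) Hs) \<times>
    foldl (ideal_prod S) (snd ` J) (map ((`) snd) Hs)"
  unfolding pr1.ring.image_foldl_ideal_prod[OF assms, symmetric]
    pr2.ring.image_foldl_ideal_prod[OF assms, symmetric]
  by (rule ideal_eq_Times[OF P.foldl_ideal_prod_ideal[OF assms]])

lemma regular_elements_P: "regular_elements P = regular_elements R \<times> regular_elements S"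
proof (intro equalityI subsetI)
  fix p assume p: "p \<in> regular_elements P"
  obtain a b where ab: "p = (a, b)" by (cases p)
  have c: "a \<in> carrier R" "b \<in> carrier S"
    using P.regular_closed[OF p] by (auto simp: ab RDirProd_carrier)
  \<comment> \<open>Used below with y = 0 and with x = 0, which tests each coordinate
    separately.\<close>
  have reg: "x = \<zero>\<^bsub>R\<^esub> \<and> y = \<zero>\<^bsub>S\<^esub>" if "x \<in> carrier R" "y \<in> carrier S"
    "a \<otimes>\<^bsub>R\<^esub> x = \<zero>\<^bsub>R\<^esub>" "b \<otimes>\<^bsub>S\<^esub> y = \<zero>\<^bsub>S\<^esub>" for x y
  proof -
    have "(a, b) \<otimes>\<^bsub>P\<^esub> (x, y) = \<zero>\<^bsub>P\<^esub>" "(x, y) \<in> carrier P"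
      using that by (simp_all add: RDirProd_simps RDirProd_carrier)
    then have "(x, y) = \<zero>\<^bsub>P\<^esub>" using p unfolding ab regular_elements_def by blast
    then show ?thesis by (simp add: RDirProd_simps)
  qed
  show "p \<in> regular_elements R \<times> regular_elements S"
    unfolding ab regular_elements_def
    using c reg[of _ "\<zero>\<^bsub>S\<^esub>"] reg[of "\<zero>\<^bsub>R\<^esub>"] by simp
next
  fix p assume "p \<in> regular_elements R \<times> regular_elements S"
  then obtain a b where ab: "p = (a, b)" "a \<in> regular_elements R" "b \<in> regular_elements S"
    by blast
  have "q = \<zero>\<^bsub>P\<^esub>" if qP: "q \<in> carrier P" and pq: "p \<otimes>\<^bsub>P\<^esub> q = \<zero>\<^bsub>P\<^esub>" for q
  proof -
    obtain x y where q: "q = (x, y)" "x \<in> carrier R" "y \<in> carrier S"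
      using qP by (auto simp: RDirProd_carrier)
    have "a \<otimes>\<^bsub>R\<^esub> x = \<zero>\<^bsub>R\<^esub>" "b \<otimes>\<^bsub>S\<^esub> y = \<zero>\<^bsub>S\<^esub>"
      using pq by (simp_all add: ab(1) q(1) RDirProd_simps)
    then show ?thesis using q ab(2,3) by (simp add: RDirProd_simps regular_elements_def)
  qed
  then show "p \<in> regular_elements P"
    using ab(2,3) unfolding ab(1)
    by (simp add: regular_elements_def RDirProd_carrier)
qed

text \<open>The witnesses combine coordinatewise: (I x J)(L x M) = sR x tS, which is generated by
  the regular element (s,t).\<close>

lemma Times_invertible_ideal:
  assumes "invertible_ideal R I" "invertible_ideal S J"
  shows "invertible_ideal P (I \<times> J)"
proof -
  have I: "ideal I R" and J: "ideal J S" using assms by (simp_all add: invertible_ideal_def)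
  obtain L s where L: "ideal L R" "s \<in> regular_elements R" "ideal_prod R I L = PIdl\<^bsub>R\<^esub> s"
    using R.invertible_idealE[OF assms(1)] by metis
  obtain M t where M: "ideal M S" "t \<in> regular_elements S" "ideal_prod S J M = PIdl\<^bsub>S\<^esub> t"
    using S.invertible_idealE[OF assms(2)] by metis
  note ids = Times_ideal[OF I J] Times_ideal[OF L(1) M(1)]
  \<comment> \<open>A rectangle projects onto its sides only when neither side is empty.\<close>
  have ne: "I \<noteq> {}" "J \<noteq> {}" "L \<noteq> {}" "M \<noteq> {}"
    using I J L(1) M(1) by (auto dest!: ideal.axioms(1) additive_subgroup.zero_closed)
  have "ideal_prod P (I \<times> J) (L \<times> M) = (PIdl\<^bsub>R\<^esub> s) \<times> (PIdl\<^bsub>S\<^esub> t)"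
    \<comment> \<open>A one-element list turns the iterated product into the binary one.\<close>
    using foldl_ideal_prod_eq_Times[OF ids(1), of "[L \<times> M]"] ids(2) ne L(3) M(3) by simp
  also have "\<dots> = PIdl\<^bsub>P\<^esub> (s, t)"
    by (force simp: cgenideal_def RDirProd_carrier RDirProd_simps)
  finally show ?thesis
    using P.invertible_idealI[OF ids, of "(s, t)"] L(2) M(2) by (simp add: regular_elements_P)
qed

end

lemma (in strongly_ISP_ring) ideal_factorization:
  assumes "ideal K R"
  obtains J Hs where "invertible_ideal R J" "\<forall>H \<in> set Hs. radical_ideal R H"
    "K = foldl (ideal_prod R) J Hs" "Hs = [] \<Longrightarrow> K = carrier R"
proof (cases "K = carrier R")
  case True
  then show ?thesis using that[of "carrier R" "[]"] invertible_carrier by simp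
next
  case False
  then show ?thesis using that proper_ideal_factorization[OF assms] by metis
qed

lemma strongly_ISP_ring_RDirProd:
  assumes "strongly_ISP_ring R" "strongly_ISP_ring S"
  shows "strongly_ISP_ring (RDirProd R S)"
proof -
  interpret R: strongly_ISP_ring R by fact
  interpret S: strongly_ISP_ring S by fact
  interpret cring_product R S by unfold_locales
  show ?thesis
  proof (intro strongly_ISP_ring.intro strongly_ISP_ring_axioms.intro cring_P)
    show "\<one>\<^bsub>P\<^esub> \<noteq> \<zero>\<^bsub>P\<^esub>" using R.one_not_zero by (simp add: RDirProd_simps)
    fix K assume K: "ideal K P" "K \<noteq> carrier P"
    obtain J Hs where J: "invertible_ideal R J" "\<forall>H \<in> set Hs. radical_ideal R H"
      "fst ` K = foldl (ideal_prod R) J Hs" "Hs = [] \<Longrightarrow> fst ` K = carrier R"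
      using R.ideal_factorization[OF pr1.ring.image_ideal[OF K(1) fst_surj]] by metis
    obtain L Ms where L: "invertible_ideal S L" "\<forall>M \<in> set Ms. radical_ideal S M"
      "snd ` K = foldl (ideal_prod S) L Ms" "Ms = [] \<Longrightarrow> snd ` K = carrier S"
      using S.ideal_factorization[OF pr2.ring.image_ideal[OF K(1) snd_surj]] by metis
    \<comment> \<open>V H is H x S and W M is R x M. As preimages under the projections they are
      radical ideals of the product ring.\<close>
    define V where "V H = {p \<in> carrier P. fst p \<in> H}" for H
    define W where "W M = {p \<in> carrier P. snd p \<in> M}" for M
    have JL: "ideal J R" "ideal L S" using J(1) L(1) by (simp_all add: invertible_ideal_def)
    have V: "fst ` V H = H" "snd ` V H = carrier S" if "H \<in> set Hs" for H
    proof -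
      interpret H: ideal H R using J(2) that by (simp add: radical_ideal_def)
      have "V H = H \<times> carrier S" using H.Icarr by (auto simp: V_def RDirProd_carrier)
      then show "fst ` V H = H" "snd ` V H = carrier S"
        using H.zero_closed S.zero_closed by (metis fst_image_times snd_image_times empty_iff)+
    qed
    have W: "fst ` W M = carrier R" "snd ` W M = M" if "M \<in> set Ms" for M
    proof -
      interpret M: ideal M S using L(2) that by (simp add: radical_ideal_def)
      have "W M = carrier R \<times> M" using M.Icarr by (auto simp: W_def RDirProd_carrier)
      then show "fst ` W M = carrier R" "snd ` W M = M"
        using M.zero_closed R.zero_closed by (metis fst_image_times snd_image_times empty_iff)+
    qed
    let ?Hs = "map V Hs @ map W Ms"
    have rad: "\<forall>H \<in> set ?Hs. radical_ideal P H"
      using J(2) L(2) pr1.ring.vimage_radical_ideal pr2.ring.vimage_radical_ideal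
      by (auto simp: V_def W_def)
    have "fst ` (J \<times> L) = J" "snd ` (J \<times> L) = L"
      using JL by (auto dest!: ideal.axioms(1) additive_subgroup.zero_closed simp: image_iff)
    \<comment> \<open>Each coordinate sees its own factors and copies of the whole ring, so the two
      given factorizations reappear side by side.\<close>
    moreover have "map ((`) fst) ?Hs = Hs @ map (\<lambda>M. carrier R) Ms"
      "map ((`) snd) ?Hs = map (\<lambda>H. carrier S) Hs @ Ms"
      using V W by (simp_all add: map_idI)
    moreover have "ideal (fst ` K) R" by (rule pr1.ring.image_ideal[OF K(1) fst_surj])
    moreover have "\<forall>H \<in> set ?Hs. ideal H P" using rad by (simp add: radical_ideal_def)
    ultimately have "foldl (ideal_prod P) (J \<times> L) ?Hs = fst ` K \<times> snd ` K"
      using foldl_ideal_prod_eq_Times[OF Times_ideal[OF JL], of ?Hs]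
        R.foldl_ideal_prod_carrier S.foldl_ideal_prod_carrier JL J(3) L(3) by simp
    then have "K = foldl (ideal_prod P) (J \<times> L) ?Hs" using ideal_eq_Times[OF K(1)] by simp
    \<comment> \<open>Both lists can be empty only if both projections of \<open>K\<close> are whole
      rings, which properness of \<open>K\<close> excludes.\<close>
    moreover have "?Hs \<noteq> []"
    proof
      assume "?Hs = []"
      then have "fst ` K = carrier R" "snd ` K = carrier S" using J(4) L(4) by auto
      then have "K = carrier R \<times> carrier S" using ideal_eq_Times[OF K(1)] by metis
      then show False using K(2) by (simp add: RDirProd_carrier)
    qed
    ultimately show "\<exists>J Hs. invertible_ideal P J \<and> Hs \<noteq> [] \<and> (\<forall>H \<in> set Hs. radical_ideal P H) \<and>
        K = foldl (ideal_prod P) J Hs"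
      using rad Times_invertible_ideal[OF J(1) L(1)] by metis
  qed
qed


section \<open>Finitely generated idempotent ideals\<close>

text \<open>The sum of the principal ideal of x and \<open>Idl T\<close> is an ideal containing all
  the generators, so it contains the ideal they generate. This allows one generator to be split
  off.\<close>

lemma (in cring) Idl_insert_cases:
  assumes "x \<in> carrier R" "T \<subseteq> carrier R" "y \<in> Idl (insert x T)"
  obtains r t where "r \<in> carrier R" "t \<in> Idl T" "y = r \<otimes> x \<oplus> t"
proof -
  interpret X: ideal "PIdl x" R by (rule cgenideal_ideal[OF assms(1)])
  interpret T: ideal "Idl T" R by (rule genideal_ideal[OF assms(2)])
  have "ideal (PIdl x <+> Idl T) R" by (rule add_ideals[OF X.is_ideal T.is_ideal])
  moreover have "insert x T \<subseteq> PIdl x <+> Idl T"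
  proof (intro insert_subsetI subsetI)
    have "x \<oplus> \<zero> \<in> PIdl x <+> Idl T"
      unfolding set_add_def' using cgenideal_self[OF assms(1)] T.zero_closed by blast
    then show "x \<in> PIdl x <+> Idl T" using assms(1) by simp
    fix t assume t: "t \<in> T"
    then have "\<zero> \<oplus> t \<in> PIdl x <+> Idl T"
      unfolding set_add_def' using genideal_self[OF assms(2)] X.zero_closed by blast
    then show "t \<in> PIdl x <+> Idl T" using t assms(2) by auto
  qed
  ultimately have "y \<in> PIdl x <+> Idl T" using genideal_minimal assms(3) by blast
  then show ?thesis using that unfolding set_add_def' cgenideal_def by blast
qed

text \<open>The induction removes the generators one at a time: if $(1-a)I \subseteq (x) + (T)$, then
  $(1-a)x \in I\,((x) + (T))$, so $(1-a-c)x \in (T)$ for some $c \in I$, and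
  $(1-a-c)(1-a)I \subseteq (T)$.\<close>

lemma (in cring) finitely_generated_idempotent_ideal:
  assumes I: "ideal I R" and "finite S" "S \<subseteq> carrier R" "I = Idl S" and idem: "ideal_prod R I I = I"
  obtains e where "e \<in> I" "\<And>x. x \<in> I \<Longrightarrow> e \<otimes> x = x"
proof -
  interpret I: ideal I R by (rule I)
  \<comment> \<open>The invariant is (1-a)I \<subseteq> (T) with a in \<open>I\<close>. It starts
    with a = 0 and T = S; once T is empty, (1-a)I = 0 and a acts as the identity on
    \<open>I\<close>.\<close>
  have reduce: "\<exists>e \<in> I. \<forall>y \<in> I. e \<otimes> y = y"
    if "finite T" "T \<subseteq> I" "a \<in> I" "\<forall>y \<in> I. y \<ominus> a \<otimes> y \<in> Idl T" for T a
    using that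
  proof (induction T arbitrary: a rule: finite_induct)
    case empty
    have "Idl {} = {\<zero>}"
      using genideal_minimal[OF zeroideal, of "{}"] ideal.axioms(1)[OF genideal_ideal[of "{}"]]
      by (auto dest: additive_subgroup.zero_closed)
    then have "y \<ominus> a \<otimes> y = \<zero>" if "y \<in> I" for y using empty that by blast
    then have "a \<otimes> y = y" if "y \<in> I" for y using that empty(2) by (metis I.Icarr m_closed r_right_minus_eq)
    then show ?case using empty(2) by blast
  next
    case (insert x T)
    note a = insert.prems(2)
    have x: "x \<in> I" and T: "T \<subseteq> I" using insert.prems(1) by auto
    have Tc: "T \<subseteq> carrier R" using T I.Icarr by blast
    interpret T: ideal "Idl T" R by (rule genideal_ideal[OF Tc])
    note carr [simp] = I.Icarr T.Icarr
    have split: "\<exists>r \<in> carrier R. \<exists>t \<in> Idl T. y \<ominus> a \<otimes> y = r \<otimes> x \<oplus> t" if "y \<in> I" for y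
      using insert.prems(3) that Idl_insert_cases[OF I.Icarr[OF x] Tc] by metis
    \<comment> \<open>For a product ij, writing (1-a)j = rx + t gives (1-a)ij - (ir)x = it, so c =
      ir works; for sums the coefficients c add. Idempotence allows y = x afterwards.\<close>
    have "\<exists>c \<in> I. y \<ominus> a \<otimes> y \<ominus> c \<otimes> x \<in> Idl T" if "y \<in> ideal_prod R I I" for y
      using that
    proof induction
      case (prod i j)
      obtain r t where r: "r \<in> carrier R" "t \<in> Idl T" "j \<ominus> a \<otimes> j = r \<otimes> x \<oplus> t"
        using split[OF prod(2)] by blast
      note [simp] = prod a x r
      have "i \<otimes> j \<ominus> a \<otimes> (i \<otimes> j) \<ominus> (i \<otimes> r) \<otimes> x = i \<otimes> (j \<ominus> a \<otimes> j) \<ominus> i \<otimes> (r \<otimes> x)"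
        using I.Icarr[OF prod(1)] I.Icarr[OF prod(2)] I.Icarr[OF a] I.Icarr[OF x] r(1) by algebra
      also have "\<dots> = i \<otimes> t"
        unfolding r(3) using I.Icarr[OF prod(1)] I.Icarr[OF x] r(1) T.Icarr[OF r(2)] by algebra
      also have "\<dots> \<in> Idl T" using r(2) I.Icarr[OF prod(1)] by (rule T.I_l_closed)
      finally show ?case using I.I_r_closed[OF prod(1) r(1)] by blast
    next
      case (sum y z)
      then obtain c d where cd: "c \<in> I" "y \<ominus> a \<otimes> y \<ominus> c \<otimes> x \<in> Idl T"
        "d \<in> I" "z \<ominus> a \<otimes> z \<ominus> d \<otimes> x \<in> Idl T" by blast
      have yz: "y \<in> carrier R" "z \<in> carrier R" using sum.hyps idem by auto
      have "y \<oplus> z \<ominus> a \<otimes> (y \<oplus> z) \<ominus> (c \<oplus> d) \<otimes> x =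
          (y \<ominus> a \<otimes> y \<ominus> c \<otimes> x) \<oplus> (z \<ominus> a \<otimes> z \<ominus> d \<otimes> x)"
        using yz I.Icarr[OF cd(1)] I.Icarr[OF cd(3)] I.Icarr[OF a] I.Icarr[OF x] by algebra
      then show ?case using cd T.a_closed I.a_closed by metis
    qed
    then obtain c where c: "c \<in> I" "x \<ominus> a \<otimes> x \<ominus> c \<otimes> x \<in> Idl T"
      using x idem by metis
    define d where "d = a \<oplus> c"
    have d: "d \<in> I" using a c(1) by (simp add: d_def)
    have "x \<ominus> d \<otimes> x = x \<ominus> a \<otimes> x \<ominus> c \<otimes> x"
      unfolding d_def using I.Icarr[OF c(1)] I.Icarr[OF a] I.Icarr[OF x] by algebra
    then have dx: "x \<ominus> d \<otimes> x \<in> Idl T" using c(2) by simp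
    \<comment> \<open>The new multiplier is chosen so that 1 - (a + d - da) = (1-d)(1-a). The factor
      1-a reduces \<open>I\<close> to (x) + (T), and 1-d moves x into (T).\<close>
    have "y \<ominus> (a \<oplus> d \<ominus> d \<otimes> a) \<otimes> y \<in> Idl T" if y: "y \<in> I" for y
    proof -
      obtain r t where r: "r \<in> carrier R" "t \<in> Idl T" "y \<ominus> a \<otimes> y = r \<otimes> x \<oplus> t"
        using split[OF y] by blast
      have "y \<ominus> (a \<oplus> d \<ominus> d \<otimes> a) \<otimes> y = (y \<ominus> a \<otimes> y) \<ominus> d \<otimes> (y \<ominus> a \<otimes> y)"
        using I.Icarr[OF d] I.Icarr[OF a] I.Icarr[OF y] by algebra
      also have "\<dots> = r \<otimes> (x \<ominus> d \<otimes> x) \<oplus> (\<one> \<ominus> d) \<otimes> t"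
        unfolding r(3) using I.Icarr[OF d] I.Icarr[OF x] r(1) T.Icarr[OF r(2)] by algebra
      also have "\<dots> \<in> Idl T"
        using dx r d by (intro T.a_closed T.I_l_closed) simp_all
      finally show ?thesis .
    qed
    moreover have "a \<oplus> d \<ominus> d \<otimes> a \<in> I"
      unfolding minus_eq using a d by (intro I.a_closed I.a_inv_closed I.I_l_closed) simp_all
    ultimately show ?case using insert.IH[OF T] by blast
  qed
  have S: "S \<subseteq> I" using assms(3,4) genideal_self by blast
  have "y \<ominus> \<zero> \<otimes> y \<in> Idl S" if "y \<in> I" for y
    using that assms(4) by (simp add: minus_eq I.Icarr)
  then show ?thesis using reduce[OF assms(2) S I.zero_closed] that by blast
qed


section \<open>The amalgamated duplication\<close>

context cring
begin

text \<open>The expression a + e(b-a) is (1-e)a + eb, the second coordinate of the map from A x A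
  onto \<open>A \<bowtie> I\<close>. This is its additivity.\<close>

lemma idempotent_mix_add:
  assumes "a \<in> carrier R" "b \<in> carrier R" "c \<in> carrier R" "d \<in> carrier R" "e \<in> carrier R"
  shows "(a \<oplus> e \<otimes> (b \<ominus> a)) \<oplus> (c \<oplus> e \<otimes> (d \<ominus> c)) = (a \<oplus> c) \<oplus> e \<otimes> ((b \<oplus> d) \<ominus> (a \<oplus> c))"
proof -
  have "(b \<oplus> d) \<ominus> (a \<oplus> c) = (b \<ominus> a) \<oplus> (d \<ominus> c)"
    using assms(1-4) by (simp add: minus_eq minus_add a_ac)
  then show ?thesis
    using assms by (simp add: r_distr a_ac)
qed

lemma idempotent_mix_mult:
  assumes carr: "a \<in> carrier R" "b \<in> carrier R" "c \<in> carrier R" "d \<in> carrier R" "e \<in> carrier R"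
    and ee: "e \<otimes> e = e"
  shows "(a \<oplus> e \<otimes> (b \<ominus> a)) \<otimes> (c \<oplus> e \<otimes> (d \<ominus> c)) = a \<otimes> c \<oplus> e \<otimes> (b \<otimes> d \<ominus> a \<otimes> c)"
proof -
  \<comment> \<open>With u = b-a and v = d-c, the relation ee = e merges the two terms carrying e;
    the remaining bracket av + uc + uv equals bd - ac.\<close>
  have expand: "(a \<oplus> e \<otimes> u) \<otimes> (c \<oplus> e \<otimes> v) = a \<otimes> c \<oplus> (e \<otimes> (a \<otimes> v \<oplus> u \<otimes> c) \<oplus> (e \<otimes> e) \<otimes> (u \<otimes> v))"
    and factor: "e \<otimes> (a \<otimes> v \<oplus> u \<otimes> c) \<oplus> e \<otimes> (u \<otimes> v) = e \<otimes> (a \<otimes> v \<oplus> u \<otimes> c \<oplus> u \<otimes> v)"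
    if "u \<in> carrier R" "v \<in> carrier R" for u v
    using carr that by algebra+
  have "a \<otimes> (d \<ominus> c) \<oplus> (b \<ominus> a) \<otimes> c \<oplus> (b \<ominus> a) \<otimes> (d \<ominus> c) = b \<otimes> d \<ominus> a \<otimes> c"
    using carr(1-4) by algebra
  then show ?thesis
    using carr by (simp add: expand factor ee minus_closed)
qed

text \<open>Because ei = i, multiplying by i removes the (1-e)a part: ((1-e)a + eb)i = bi.\<close>

lemma idempotent_mix_eq_zeroD:
  assumes "a \<in> carrier R" "b \<in> carrier R" "e \<in> carrier R" "i \<in> carrier R" "e \<otimes> i = i"
    and "(a \<oplus> e \<otimes> (b \<ominus> a)) \<otimes> i = \<zero>"
  shows "b \<otimes> i = \<zero>"
proof -
  have "b \<otimes> i = a \<otimes> i \<oplus> (b \<ominus> a) \<otimes> i" using assms(1,2,4) by algebra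
  also have "\<dots> = a \<otimes> i \<oplus> (b \<ominus> a) \<otimes> (e \<otimes> i)" by (simp only: assms(5))
  also have "\<dots> = (a \<oplus> e \<otimes> (b \<ominus> a)) \<otimes> i" using assms(1-4) by algebra
  finally show ?thesis using assms(6) by simp
qed

end

lemma amalgamated_duplication_simps:
  "(a, b) \<oplus>\<^bsub>A \<bowtie> I\<^esub> (c, d) = (a \<oplus>\<^bsub>A\<^esub> c, b \<oplus>\<^bsub>A\<^esub> d)"
  "(a, b) \<otimes>\<^bsub>A \<bowtie> I\<^esub> (c, d) = (a \<otimes>\<^bsub>A\<^esub> c, b \<otimes>\<^bsub>A\<^esub> d)"
  "\<one>\<^bsub>A \<bowtie> I\<^esub> = (\<one>\<^bsub>A\<^esub>, \<one>\<^bsub>A\<^esub>)"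
  "\<zero>\<^bsub>A \<bowtie> I\<^esub> = (\<zero>\<^bsub>A\<^esub>, \<zero>\<^bsub>A\<^esub>)"
  "carrier (A \<bowtie> I) = {(a, a \<oplus>\<^bsub>A\<^esub> i) | a i. a \<in> carrier A \<and> i \<in> I}"
  by (simp_all add: amalgamated_duplication_def RDirProd_def DirProd_def monoid.defs)

locale duplication = cring A + ideal I A for A (structure) and I
begin

lemma cring_duplication: "cring (A \<bowtie> I)"
  by (rule amalgamated_duplication_cring[OF is_ideal])

lemma duplication_memI: "\<lbrakk>a \<in> carrier A; i \<in> I\<rbrakk> \<Longrightarrow> (a, a \<oplus> i) \<in> carrier (A \<bowtie> I)"
  by (auto simp: amalgamated_duplication_simps)

lemma fst_hom: "ring_hom_cring (A \<bowtie> I) A fst"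
  by (intro ring_hom_cring.intro ring_hom_cring_axioms.intro cring_duplication cring_axioms
      ring_hom_memI) (auto simp: amalgamated_duplication_simps)

text \<open>If $(a, a+i)$ is regular and $ab = 0$, then $(a, a+i)(ib, 0) = 0$ yields $ib = 0$, whence
  $(a, a+i)(b, b) = 0$ and $b = 0$.\<close>

lemma fst_regular: "fst ` regular_elements (A \<bowtie> I) \<subseteq> regular_elements A"
proof
  fix a assume "a \<in> fst ` regular_elements (A \<bowtie> I)"
  then obtain i where a: "a \<in> carrier A" and i: "i \<in> I"
    and reg: "\<And>p. \<lbrakk>p \<in> carrier (A \<bowtie> I); (a, a \<oplus> i) \<otimes>\<^bsub>A \<bowtie> I\<^esub> p = (\<zero>, \<zero>)\<rbrakk> \<Longrightarrow> p = (\<zero>, \<zero>)"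
    by (force simp: regular_elements_def amalgamated_duplication_simps)
  note ic = Icarr[OF i]
  have "b = \<zero>" if b: "b \<in> carrier A" "a \<otimes> b = \<zero>" for b
  proof -
    have ib: "i \<otimes> b \<in> I" using i b by (simp add: I_r_closed)
    \<comment> \<open>The pair is (ib, 0), written so that its membership in
      \<open>A \<bowtie> I\<close> is visible: the two coordinates differ by an element of
      \<open>I\<close>.\<close>
    have "(i \<otimes> b, i \<otimes> b \<oplus> \<ominus> (i \<otimes> b)) = (\<zero>, \<zero>)"
    proof (rule reg[OF duplication_memI])
      have "a \<otimes> (i \<otimes> b) = \<zero>" using a b ic m_lcomm[of a i b] by simp
      then show "(a, a \<oplus> i) \<otimes>\<^bsub>A \<bowtie> I\<^esub> (i \<otimes> b, i \<otimes> b \<oplus> \<ominus> (i \<otimes> b)) = (\<zero>, \<zero>)"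
        using a b ic by (simp add: amalgamated_duplication_simps r_neg)
    qed (use ib b ic in simp_all)
    then have "(a \<oplus> i) \<otimes> b = \<zero>" using a b ic by (simp add: l_distr)
    then have "(b, b \<oplus> \<zero>) = (\<zero>, \<zero>)"
      using a b by (intro reg[OF duplication_memI]) (simp_all add: amalgamated_duplication_simps)
    then show ?thesis by simp
  qed
  then show "a \<in> regular_elements A" using a by (simp add: regular_elements_def)
qed

lemma strongly_ISP_ring_of_duplication:
  assumes "strongly_ISP_ring (A \<bowtie> I)" "\<one> \<noteq> \<zero>"
  shows "strongly_ISP_ring A"
proof -
  interpret fst: ring_hom_cring "A \<bowtie> I" A fst by (rule fst_hom)
  have "fst ` carrier (A \<bowtie> I) = carrier A"
  proof (intro equalityI subsetI)
    fix a assume "a \<in> carrier A"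
    then have "(a, a \<oplus> \<zero>) \<in> carrier (A \<bowtie> I)" using zero_closed by (rule duplication_memI)
    then show "a \<in> fst ` carrier (A \<bowtie> I)" by (rule image_eqI[rotated]) simp
  qed (use fst.hom_closed in blast)
  then show ?thesis using fst.strongly_ISP_ring_image assms fst_regular by blast
qed

lemma strongly_ISP_ring_duplication:
  assumes ISP: "strongly_ISP_ring A" and e: "e \<in> I" "\<And>x. x \<in> I \<Longrightarrow> e \<otimes> x = x"
  shows "strongly_ISP_ring (A \<bowtie> I)"
proof -
  interpret D: cring "A \<bowtie> I" by (rule cring_duplication)
  interpret cring_product A A by unfold_locales
  note ec = Icarr[OF e(1)]
  have ee: "e \<otimes> e = e" by (rule e(2)[OF e(1)])
  \<comment> \<open>The coordinates of the image differ by e(b-a), which lies in \<open>I\<close>,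
    so h maps into \<open>A \<bowtie> I\<close>.\<close>
  define h where "h = (\<lambda>(a, b). (a, a \<oplus> e \<otimes> (b \<ominus> a)))"
  have h: "h p \<in> carrier (A \<bowtie> I)" if "p \<in> carrier P" for p
    using that e(1) by (auto simp: h_def RDirProd_carrier I_r_closed intro!: duplication_memI)
  interpret h: ring_hom_cring P "A \<bowtie> I" h
  proof (intro ring_hom_cring.intro ring_hom_cring_axioms.intro cring_P cring_duplication
      ring_hom_memI h)
    fix p q assume "p \<in> carrier P" "q \<in> carrier P"
    then obtain a b c d where pq: "p = (a, b)" "q = (c, d)"
      and carr: "a \<in> carrier A" "b \<in> carrier A" "c \<in> carrier A" "d \<in> carrier A"
      by (auto simp: RDirProd_carrier)
    have "(a \<oplus> e \<otimes> (b \<ominus> a)) \<otimes> (c \<oplus> e \<otimes> (d \<ominus> c)) = a \<otimes> c \<oplus> e \<otimes> (b \<otimes> d \<ominus> a \<otimes> c)"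
      by (rule idempotent_mix_mult[OF carr ec ee])
    then show "h (p \<otimes>\<^bsub>P\<^esub> q) = h p \<otimes>\<^bsub>A \<bowtie> I\<^esub> h q"
      by (simp add: pq h_def RDirProd_simps amalgamated_duplication_simps)
    have "(a \<oplus> e \<otimes> (b \<ominus> a)) \<oplus> (c \<oplus> e \<otimes> (d \<ominus> c)) = (a \<oplus> c) \<oplus> e \<otimes> ((b \<oplus> d) \<ominus> (a \<oplus> c))"
      by (rule idempotent_mix_add[OF carr ec])
    then show "h (p \<oplus>\<^bsub>P\<^esub> q) = h p \<oplus>\<^bsub>A \<bowtie> I\<^esub> h q"
      by (simp add: pq h_def RDirProd_simps amalgamated_duplication_simps)
  next
    show "h \<one>\<^bsub>P\<^esub> = \<one>\<^bsub>A \<bowtie> I\<^esub>"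
      using ec by (simp add: h_def RDirProd_simps amalgamated_duplication_simps minus_eq r_neg)
  qed
  \<comment> \<open>h fixes every element of \<open>A \<bowtie> I\<close>, because e((a+i) - a) = ei
    = i. This gives surjectivity.\<close>
  have "(a, a \<oplus> i) \<in> h ` carrier P" if "a \<in> carrier A" "i \<in> I" for a i
  proof (rule image_eqI)
    have "(a \<oplus> i) \<ominus> a = i"
      using that(1) Icarr[OF that(2)] by (simp add: minus_eq a_comm[of a i] a_assoc r_neg)
    then show "(a, a \<oplus> i) = h (a, a \<oplus> i)" using that e(2) by (simp add: h_def)
    show "(a, a \<oplus> i) \<in> carrier P" using that Icarr by (simp add: RDirProd_carrier)
  qed
  then have surj: "h ` carrier P = carrier (A \<bowtie> I)"
    using h by (auto simp: amalgamated_duplication_simps(5))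
  have "h p \<in> regular_elements (A \<bowtie> I)" if p: "p \<in> regular_elements P" for p
  proof -
    obtain a b where ab: "p = (a, b)" "a \<in> regular_elements A" "b \<in> regular_elements A"
      using p by (auto simp: regular_elements_P)
    note carr = ab(2,3)[THEN regular_closed]
    have "q = \<zero>\<^bsub>A \<bowtie> I\<^esub>" if q: "q \<in> carrier (A \<bowtie> I)" and 0: "h p \<otimes>\<^bsub>A \<bowtie> I\<^esub> q = \<zero>\<^bsub>A \<bowtie> I\<^esub>" for q
    proof -
      obtain x i where xi: "q = (x, x \<oplus> i)" "x \<in> carrier A" "i \<in> I"
        using q by (auto simp: amalgamated_duplication_simps)
      note ic = Icarr[OF xi(3)]
      \<comment> \<open>The first coordinate forces x = 0; the second then says that the mix of a
        and b annihilates i, which amounts to bi = 0.\<close>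
      have ax: "a \<otimes> x = \<zero>" and bi: "(a \<oplus> e \<otimes> (b \<ominus> a)) \<otimes> (x \<oplus> i) = \<zero>"
        using 0 by (simp_all add: ab(1) xi(1) h_def amalgamated_duplication_simps)
      have x: "x = \<zero>" using ab(2) ax xi(2) by (simp add: regular_elements_def)
      have "b \<otimes> i = \<zero>"
        using bi ic by (intro idempotent_mix_eq_zeroD[OF carr ec ic e(2)[OF xi(3)]]) (simp add: x)
      then have "i = \<zero>" using ab(3) ic by (simp add: regular_elements_def)
      then show ?thesis by (simp add: xi(1) x amalgamated_duplication_simps)
    qed
    then show ?thesis
      unfolding regular_elements_def using h[OF P.regular_closed[OF p]] by blast
  qed
  then have reg: "h ` regular_elements P \<subseteq> regular_elements (A \<bowtie> I)" by blast
  have "\<one>\<^bsub>A \<bowtie> I\<^esub> \<noteq> \<zero>\<^bsub>A \<bowtie> I\<^esub>"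
    using strongly_ISP_ring.one_not_zero[OF ISP] by (simp add: amalgamated_duplication_simps)
  then show ?thesis
    using h.strongly_ISP_ring_image[OF strongly_ISP_ring_RDirProd[OF ISP ISP] surj reg] by blast
qed

end

theorem theorem4p13:
  fixes A (structure)
  assumes "cring A" and "\<one> \<noteq> \<zero>"
    and "ideal I A"
  shows "(strongly_ISP_ring (A \<bowtie> I) \<longrightarrow> strongly_ISP_ring A) \<and>
    ((\<exists>S. finite S \<and> S \<subseteq> carrier A \<and> I = Idl S) \<and> ideal_prod A I I = I \<longrightarrow>
      (strongly_ISP_ring (A \<bowtie> I) \<longleftrightarrow> strongly_ISP_ring A))"
proof -
  interpret duplication A I using assms by (intro duplication.intro)
  \<comment> \<open>Of the equivalence in (2), only this direction remains; the other one is
    (1).\<close>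
  have "strongly_ISP_ring (A \<bowtie> I)"
    if "finite S" "S \<subseteq> carrier A" "I = Idl S" "ideal_prod A I I = I" "strongly_ISP_ring A" for S
    using finitely_generated_idempotent_ideal[OF assms(3) that(1-4)]
      strongly_ISP_ring_duplication[OF that(5)] by metis
  then show ?thesis using strongly_ISP_ring_of_duplication assms(2) by blast
qed

end
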